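(* Let $\Omega$ be an infinite set. Then $$\mathrm{I}\to\mathbb{S}_\Omega\to\mathbb{G}_\Omega\xrightarrow{\ \mathrm{Ind}\ }\mathbb{Z}\to 0$$ is a short exact sequence of groups, where $\mathbb{S}_\Omega\to\mathbb{G}_\Omega$ is the inclusion (that is, $\mathrm{Ind}$ is a surjective group homomorphism whose kernel is $\mathbb{S}_\Omega$), and this short exact sequence splits (that is, there is a group homomorphism $\phi:\mathbb{Z}\to\mathbb{G}_\Omega$ with $\mathrm{Ind}\circ\phi=\mathrm{id}_{\mathbb{Z}}$).
   Context: For $A\subseteq\Omega$ write $A'=\Omega\setminus A$; $A$ is cofinite if $A'$ is finite. $|A|$ denotes the cardinality of a finite set $A$. A function $f:\Omega\to\Omega$ is a near-bijection if there exist cofinite subsets $A,B\subseteq\Omega$ such that $f$ restricts to a bijection $A\to B$. For self-maps $f,g$ of $\Omega$, $f\equiv g$ (almost equal) means that $\{\omega: f(\omega)\neq g(\omega)\}$ is finite. A function is almost bijective if it is almost equal to a bijection $\Omega\to\Omega$; almost bijective functions are near-bijections. $\mathbb{G}_\Omega$ is the group whose elements are the $\equiv$-classes $[f]$ of near-bijections $f$ of $\Omega$, with operation $[g][f]=[g\circ f]$; $\mathbb{S}_\Omega$ is the subgroup of $\equiv$-classes of almost bijective functions. The monoset of $f$ is $\Omega_f=\{\omega\in\Omega:\ f^{-1}(\{f(\omega)\})=\{\omega\}\}$, where $f^{-1}(B)$ denotes the preimage of $B$. For a near-bijection $f$, both $\Omega_f'$ and $f(\Omega)'$ are finite and $\mathrm{ind}(f)=\big(|\Omega_f'|-|f(\Omega_f')|\big)-|f(\Omega)'|\in\mathbb{Z}$.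 The index is constant on $\equiv$-classes of near-bijections, and $\mathrm{Ind}:\mathbb{G}_\Omega\to\mathbb{Z}$ is the map $\mathrm{Ind}[f]=\mathrm{ind}(f)$. $\mathrm{I}$ denotes the trivial group. *)

theory Defs
  imports "HOL-Algebra.Elementary_Groups" "HOL-Library.FuncSet"
begin

(* Self-maps of \<Omega> are the extensional functions \<Omega> \<rightarrow>\<^sub>E \<Omega>, so that two self-maps
   are equal as HOL functions iff they agree on \<Omega>. *)

definition cofinite_in :: "'a set \<Rightarrow> 'a set \<Rightarrow> bool" where
  "cofinite_in \<Omega> A \<longleftrightarrow> A \<subseteq> \<Omega> \<and> finite (\<Omega> - A)"

definition near_bijections :: "'a set \<Rightarrow> ('a \<Rightarrow> 'a) set" where
  "near_bijections \<Omega> =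
     {f \<in> \<Omega> \<rightarrow>\<^sub>E \<Omega>. \<exists>A B. cofinite_in \<Omega> A \<and> cofinite_in \<Omega> B \<and> bij_betw f A B}"

definition almost_equal :: "'a set \<Rightarrow> ('a \<Rightarrow> 'a) rel" where
  "almost_equal \<Omega> =
     {(f, g). f \<in> \<Omega> \<rightarrow>\<^sub>E \<Omega> \<and> g \<in> \<Omega> \<rightarrow>\<^sub>E \<Omega> \<and> finite {w \<in> \<Omega>. f w \<noteq> g w}}"

definition almost_bijective :: "'a set \<Rightarrow> ('a \<Rightarrow> 'a) set" where
  "almost_bijective \<Omega> =
     {f \<in> \<Omega> \<rightarrow>\<^sub>E \<Omega>. \<exists>b \<in> \<Omega> \<rightarrow>\<^sub>E \<Omega>. bij_betw b \<Omega> \<Omega> \<and> (f, b) \<in> almost_equal \<Omega>}"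

(* The product [g][f] = [g \<circ> f] does not depend on the representatives, so the union
   in the multiplication below is a union of identical classes. *)

definition near_bijection_group :: "'a set \<Rightarrow> ('a \<Rightarrow> 'a) set monoid" where
  "near_bijection_group \<Omega> =
     \<lparr>carrier = near_bijections \<Omega> // almost_equal \<Omega>,
      monoid.mult = (\<lambda>X Y. \<Union>g\<in>X. \<Union>f\<in>Y. almost_equal \<Omega> `` {compose \<Omega> g f}),
      one = almost_equal \<Omega> `` {\<lambda>w\<in>\<Omega>. w}\<rparr>"

definition almost_bijective_group :: "'a set \<Rightarrow> ('a \<Rightarrow> 'a) set monoid" where
  "almost_bijective_group \<Omega> =
     (near_bijection_group \<Omega>)\<lparr>carrier := almost_bijective \<Omega> // almost_equal \<Omega>\<rparr>"

definition monoset :: "'a set \<Rightarrow> ('a \<Rightarrow> 'a) \<Rightarrow> 'a set" where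
  "monoset \<Omega> f = {w \<in> \<Omega>. f -` {f w} \<inter> \<Omega> = {w}}"

definition ind :: "'a set \<Rightarrow> ('a \<Rightarrow> 'a) \<Rightarrow> int" where
  "ind \<Omega> f =
     (int (card (\<Omega> - monoset \<Omega> f)) - int (card (f ` (\<Omega> - monoset \<Omega> f))))
       - int (card (\<Omega> - f ` \<Omega>))"

(* ind is constant on each class X of near-bijections; Ind X is its unique value there. *)

definition Ind :: "'a set \<Rightarrow> ('a \<Rightarrow> 'a) set \<Rightarrow> int" where
  "Ind \<Omega> X = the_elem (ind \<Omega> ` X)"

(* exact_seq from HOL-Algebra.Exact_Sequence requires all groups of a sequence to have the
   same element type, hence this heterogeneous version. *)

definition exact_at ::
  "('a, 'x) monoid_scheme \<Rightarrow> ('b, 'y) monoid_scheme \<Rightarrow> ('c, 'z) monoid_scheme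
     \<Rightarrow> ('a \<Rightarrow> 'b) \<Rightarrow> ('b \<Rightarrow> 'c) \<Rightarrow> bool" where
  "exact_at G H K f g \<longleftrightarrow>
     group_hom G H f \<and> group_hom H K g \<and> f ` carrier G = kernel H K g"

definition short_exact_seq ::
  "('a, 'x) monoid_scheme \<Rightarrow> ('b, 'y) monoid_scheme \<Rightarrow> ('c, 'z) monoid_scheme
     \<Rightarrow> ('a \<Rightarrow> 'b) \<Rightarrow> ('b \<Rightarrow> 'c) \<Rightarrow> bool" where
  "short_exact_seq N G H i p \<longleftrightarrow>
     exact_at (singleton_group \<one>\<^bsub>N\<^esub>) N G (\<lambda>x. x) i \<and>
     exact_at N G H i p \<and>
     exact_at G H (singleton_group \<one>\<^bsub>H\<^esub>) p (\<lambda>_. \<one>\<^bsub>H\<^esub>)"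

end

theory Submission
  imports Defs
begin

text \<open>
  The index counts a defect that can be read off from any cofinite restriction of the map. If \<open>f\<close>
  maps a cofinite set \<open>A\<close> bijectively onto a cofinite set \<open>B\<close>, then shrinking \<open>A\<close> by finitely many
  points enlarges the complements of \<open>A\<close> and of \<open>B\<close> by the same number of points, so
  \<open>\<bar>A'\<bar> - \<bar>B'\<bar>\<close> depends on \<open>f\<close> only. The monoset of \<open>f\<close> is one possible choice of \<open>A\<close>, and
  for it the difference is \<open>ind f\<close>. This is lemma \<open>ind_eq_codim_diff\<close>, on which everything rests.

  Choosing domains on which two maps agree, or which are matched along a composition, gives that
  \<open>ind\<close> is invariant under almost equality (\<open>ind_cong\<close>) and additive (\<open>ind_compose\<close>). If the index
  is zero, then \<open>A'\<close> and \<open>B'\<close> are finite of the same size, so the restriction \<open>A \<rightarrow> B\<close> extends to a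
  permutation of \<open>\<Omega>\<close> (\<open>almost_bijective_iff\<close>): the kernel consists of the classes of almost bijective
  maps. Finally, an injective sequence \<open>s\<close> in \<open>\<Omega>\<close> carries the shifts \<open>s k \<mapsto> s (k - n)\<close>, which have
  index \<open>n\<close> and compose additively up to finitely many points; this gives the splitting, and with it
  surjectivity.
\<close>

section \<open>Cofinite bijective restrictions and the index\<close>

definition cofinite_bij :: "'a set \<Rightarrow> ('a \<Rightarrow> 'a) \<Rightarrow> 'a set \<Rightarrow> 'a set \<Rightarrow> bool" where
  "cofinite_bij \<Omega> f A B \<longleftrightarrow> cofinite_in \<Omega> A \<and> cofinite_in \<Omega> B \<and> bij_betw f A B"

abbreviation codim :: "'a set \<Rightarrow> 'a set \<Rightarrow> int" where
  "codim \<Omega> A \<equiv> int (card (\<Omega> - A))"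

lemma near_bijections_iff:
  "f \<in> near_bijections \<Omega> \<longleftrightarrow> f \<in> \<Omega> \<rightarrow>\<^sub>E \<Omega> \<and> (\<exists>A B. cofinite_bij \<Omega> f A B)"
  by (auto simp: near_bijections_def cofinite_bij_def)

lemma near_bijectionsE:
  assumes "f \<in> near_bijections \<Omega>"
  obtains A B where "f \<in> \<Omega> \<rightarrow>\<^sub>E \<Omega>" "cofinite_bij \<Omega> f A B"
  using assms by (auto simp: near_bijections_iff)

lemma cofinite_in_Int:
  "cofinite_in \<Omega> A \<Longrightarrow> cofinite_in \<Omega> B \<Longrightarrow> cofinite_in \<Omega> (A \<inter> B)"
  by (auto simp: cofinite_in_def Diff_Int)

lemma cofinite_in_superset:
  assumes "cofinite_in \<Omega> A" "finite F" "A - F \<subseteq> B" "B \<subseteq> \<Omega>"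
  shows "cofinite_in \<Omega> B"
proof -
  have "\<Omega> - B \<subseteq> (\<Omega> - A) \<union> F" using assms by auto
  then show ?thesis using assms by (auto simp: cofinite_in_def intro: finite_subset)
qed

text \<open>The points \<open>A - D\<close> removed from the domain and their images, removed from the range, are equal
  in number.\<close>

lemma cofinite_bij_shrink:
  assumes f: "cofinite_bij \<Omega> f A B" and D: "cofinite_in \<Omega> D" "D \<subseteq> A"
  shows "cofinite_bij \<Omega> f D (f ` D)"
    and "codim \<Omega> D - codim \<Omega> (f ` D) = codim \<Omega> A - codim \<Omega> B"
proof -
  have inj: "inj_on f A" and B: "B = f ` A" and sub: "A \<subseteq> \<Omega>" "B \<subseteq> \<Omega>"
    and fin: "finite (\<Omega> - A)" "finite (\<Omega> - B)"
    using f by (auto simp: cofinite_bij_def cofinite_in_def bij_betw_def)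
  have finAD: "finite (A - D)"
    using D sub by (auto simp: cofinite_in_def intro: finite_subset[of _ "\<Omega> - D"])
  have fAD: "f ` (A - D) = B - f ` D"
    using inj D(2) B by (simp add: inj_on_image_set_diff[of f A])
  have D': "\<Omega> - D = (\<Omega> - A) \<union> (A - D)" using sub D by auto
  have fD': "\<Omega> - f ` D = (\<Omega> - B) \<union> f ` (A - D)" using sub D(2) B fAD by auto
  show "cofinite_bij \<Omega> f D (f ` D)"
    unfolding cofinite_bij_def cofinite_in_def
  proof (intro conjI)
    show "D \<subseteq> \<Omega>" "finite (\<Omega> - D)" using D by (auto simp: cofinite_in_def)
    show "f ` D \<subseteq> \<Omega>" using D(2) B sub by auto
    show "finite (\<Omega> - f ` D)" unfolding fD' using fin finAD by simp
    show "bij_betw f D (f ` D)" using inj D(2) by (meson inj_on_imp_bij_betw inj_on_subset)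
  qed
  have "card (\<Omega> - D) = card (\<Omega> - A) + card (A - D)"
    unfolding D' by (rule card_Un_disjoint) (use fin finAD in auto)
  moreover have "card (\<Omega> - f ` D) = card (\<Omega> - B) + card (f ` (A - D))"
    unfolding fD' by (rule card_Un_disjoint) (use fin finAD B in auto)
  moreover have "card (f ` (A - D)) = card (A - D)"
    by (meson Diff_subset card_image inj inj_on_subset)
  ultimately show "codim \<Omega> D - codim \<Omega> (f ` D) = codim \<Omega> A - codim \<Omega> B" by simp
qed

text \<open>Near-bijections have finite fibres: on \<open>A\<close> they are injective, and \<open>A'\<close> is finite.\<close>

lemma cofinite_bij_vimage_finite:
  assumes "cofinite_bij \<Omega> f A B" "finite F"
  shows "finite {w \<in> \<Omega>. f w \<in> F}"
proof -
  have "{w \<in> \<Omega>. f w \<in> F} \<subseteq> (\<Omega> - A) \<union> (f -` F \<inter> A)" by auto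
  moreover have "finite (f -` F \<inter> A)"
    using assms by (intro finite_vimage_IntI) (auto simp: cofinite_bij_def bij_betw_def)
  ultimately show ?thesis
    using assms by (auto simp: cofinite_bij_def cofinite_in_def intro: finite_subset)
qed

text \<open>The failure of injectivity is confined to the fibres that meet \<open>A'\<close>, which are finite in number
  and finite.\<close>

lemma cofinite_bij_monoset:
  assumes fE: "f \<in> \<Omega> \<rightarrow>\<^sub>E \<Omega>" and f: "cofinite_bij \<Omega> f A B"
  shows "cofinite_bij \<Omega> f (monoset \<Omega> f) (f ` monoset \<Omega> f)"
proof -
  let ?M = "monoset \<Omega> f"
  have inj: "inj_on f A" and B: "B = f ` A" and sub: "A \<subseteq> \<Omega>" "B \<subseteq> \<Omega>"
    and fin: "finite (\<Omega> - A)" and cof: "cofinite_in \<Omega> A" "cofinite_in \<Omega> B"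
    using f by (auto simp: cofinite_bij_def cofinite_in_def bij_betw_def)
  have "A - {w \<in> \<Omega>. f w \<in> f ` (\<Omega> - A)} \<subseteq> ?M"
  proof
    fix w assume w: "w \<in> A - {w \<in> \<Omega>. f w \<in> f ` (\<Omega> - A)}"
    then have wA: "w \<in> A" and out: "f w \<notin> f ` (\<Omega> - A)" using sub by auto
    have "v = w" if v: "v \<in> \<Omega>" "f v = f w" for v
    proof -
      have "v \<in> A"
      proof (rule ccontr)
        assume "v \<notin> A"
        then have "f v \<in> f ` (\<Omega> - A)" using v(1) by blast
        then show False using out v(2) by simp
      qed
      then show ?thesis using inj_onD[OF inj v(2)] wA by blast
    qed
    then show "w \<in> ?M" using w sub by (auto simp: monoset_def)
  qed
  moreover have "finite {w \<in> \<Omega>. f w \<in> f ` (\<Omega> - A)}"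
    using cofinite_bij_vimage_finite[OF f] fin by simp
  moreover have MS: "?M \<subseteq> \<Omega>" by (auto simp: monoset_def)
  ultimately have M: "cofinite_in \<Omega> ?M"
    using cofinite_in_superset[OF cof(1)] by blast
  have "cofinite_in \<Omega> (f ` ?M)"
  proof (rule cofinite_in_superset[OF cof(2)])
    show "finite (f ` (\<Omega> - ?M))" using M by (simp add: cofinite_in_def)
    show "B - f ` (\<Omega> - ?M) \<subseteq> f ` ?M" using B sub by auto
    show "f ` ?M \<subseteq> \<Omega>" using fE MS by auto
  qed
  moreover have "inj_on f ?M" by (auto simp: monoset_def inj_on_def)
  ultimately show ?thesis using M by (simp add: cofinite_bij_def bij_betw_def)
qed

text \<open>The complement of \<open>f(\<Omega>\<^sub>f)\<close> splits into \<open>f(\<Omega>)'\<close> and \<open>f(\<Omega>\<^sub>f')\<close>, so that \<open>ind f\<close> is the difference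
  of codimensions for the restriction of \<open>f\<close> to its monoset. Any other restriction is compared
  with this one on the intersection of the two domains.\<close>

lemma ind_eq_codim_diff:
  assumes fE: "f \<in> \<Omega> \<rightarrow>\<^sub>E \<Omega>" and f: "cofinite_bij \<Omega> f A B"
  shows "ind \<Omega> f = codim \<Omega> A - codim \<Omega> B"
proof -
  let ?M = "monoset \<Omega> f"
  have M: "cofinite_bij \<Omega> f ?M (f ` ?M)" using cofinite_bij_monoset[OF fE f] .
  have mono: "v = w" if "v \<in> \<Omega>" "w \<in> ?M" "f v = f w" for v w
    using that by (auto simp: monoset_def)
  have split: "\<Omega> - f ` ?M = (\<Omega> - f ` \<Omega>) \<union> f ` (\<Omega> - ?M)"
  proof
    show "\<Omega> - f ` ?M \<subseteq> (\<Omega> - f ` \<Omega>) \<union> f ` (\<Omega> - ?M)" by auto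
    have "f w \<notin> f ` ?M" if "w \<in> \<Omega> - ?M" for w using that mono by blast
    moreover have "?M \<subseteq> \<Omega>" by (auto simp: monoset_def)
    ultimately show "(\<Omega> - f ` \<Omega>) \<union> f ` (\<Omega> - ?M) \<subseteq> \<Omega> - f ` ?M" using fE by auto
  qed
  have disj: "(\<Omega> - f ` \<Omega>) \<inter> f ` (\<Omega> - ?M) = {}" by auto
  have fin: "finite (\<Omega> - ?M)" "finite (\<Omega> - f ` ?M)"
    using M by (auto simp: cofinite_bij_def cofinite_in_def)
  have "finite (\<Omega> - f ` \<Omega>)"
    using fin(2) split by simp
  then have "card (\<Omega> - f ` ?M) = card (\<Omega> - f ` \<Omega>) + card (f ` (\<Omega> - ?M))"
    unfolding split using fin(1) disj by (intro card_Un_disjoint) auto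
  then have "ind \<Omega> f = codim \<Omega> ?M - codim \<Omega> (f ` ?M)"
    by (simp add: ind_def)
  also have "\<dots> = codim \<Omega> (?M \<inter> A) - codim \<Omega> (f ` (?M \<inter> A))"
    using M f cofinite_bij_shrink(2)[OF M, of "?M \<inter> A"]
    by (simp add: cofinite_in_Int cofinite_bij_def)
  also have "\<dots> = codim \<Omega> A - codim \<Omega> B"
    using M f by (intro cofinite_bij_shrink(2)) (auto simp: cofinite_in_Int cofinite_bij_def)
  finally show ?thesis .
qed

section \<open>Almost equality, composition and inversion\<close>

lemma equiv_almost_equal: "equiv (\<Omega> \<rightarrow>\<^sub>E \<Omega>) (almost_equal \<Omega>)"
proof (rule equivI)
  show "almost_equal \<Omega> \<subseteq> (\<Omega> \<rightarrow>\<^sub>E \<Omega>) \<times> (\<Omega> \<rightarrow>\<^sub>E \<Omega>)" "refl_on (\<Omega> \<rightarrow>\<^sub>E \<Omega>) (almost_equal \<Omega>)"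
    by (auto simp: almost_equal_def refl_on_def)
  show "sym (almost_equal \<Omega>)"
    by (auto simp: almost_equal_def sym_def eq_commute)
  show "trans (almost_equal \<Omega>)"
  proof (rule transI)
    fix f g h assume fg: "(f, g) \<in> almost_equal \<Omega>" and gh: "(g, h) \<in> almost_equal \<Omega>"
    have "{w \<in> \<Omega>. f w \<noteq> h w} \<subseteq> {w \<in> \<Omega>. f w \<noteq> g w} \<union> {w \<in> \<Omega>. g w \<noteq> h w}" by auto
    then have "finite {w \<in> \<Omega>. f w \<noteq> h w}"
      using fg gh by (auto simp: almost_equal_def intro: finite_subset)
    then show "(f, h) \<in> almost_equal \<Omega>" using fg gh by (simp add: almost_equal_def)
  qed
qed

lemma cofinite_bij_almost_equal:
  assumes fg: "(f, g) \<in> almost_equal \<Omega>" and f: "cofinite_bij \<Omega> f A B"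
  obtains C D where "cofinite_bij \<Omega> f C D" "cofinite_bij \<Omega> g C D"
proof -
  define C where "C = A \<inter> {w \<in> \<Omega>. f w = g w}"
  have "\<Omega> - {w \<in> \<Omega>. f w = g w} = {w \<in> \<Omega>. f w \<noteq> g w}" by auto
  then have "cofinite_in \<Omega> {w \<in> \<Omega>. f w = g w}"
    using fg by (auto simp: cofinite_in_def almost_equal_def)
  then have "cofinite_in \<Omega> C"
    using f by (simp add: C_def cofinite_in_Int cofinite_bij_def)
  then have fC: "cofinite_bij \<Omega> f C (f ` C)"
    using f by (intro cofinite_bij_shrink(1)) (auto simp: C_def)
  moreover have "bij_betw f C (f ` C) \<longleftrightarrow> bij_betw g C (f ` C)"
    by (rule bij_betw_cong) (simp add: C_def)
  ultimately show thesis using that[of C "f ` C"] by (simp add: cofinite_bij_def)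
qed

lemma near_bijections_cong:
  assumes fg: "(f, g) \<in> almost_equal \<Omega>" and "f \<in> near_bijections \<Omega>"
  shows "g \<in> near_bijections \<Omega>"
proof -
  obtain A B where "cofinite_bij \<Omega> f A B" using assms(2) by (rule near_bijectionsE)
  then show ?thesis
    using cofinite_bij_almost_equal[OF fg] fg by (metis (no_types, lifting) almost_equal_def
      near_bijections_iff mem_Collect_eq case_prodD)
qed

lemma ind_cong:
  assumes fg: "(f, g) \<in> almost_equal \<Omega>" and "f \<in> near_bijections \<Omega>"
  shows "ind \<Omega> f = ind \<Omega> g"
proof -
  obtain A B where "cofinite_bij \<Omega> f A B" using assms(2) by (rule near_bijectionsE)
  then obtain C D where "cofinite_bij \<Omega> f C D" "cofinite_bij \<Omega> g C D"
    using cofinite_bij_almost_equal[OF fg] by blast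
  moreover have "f \<in> \<Omega> \<rightarrow>\<^sub>E \<Omega>" "g \<in> \<Omega> \<rightarrow>\<^sub>E \<Omega>" using fg by (auto simp: almost_equal_def)
  ultimately show ?thesis by (simp add: ind_eq_codim_diff)
qed

lemma almost_equal_compose:
  assumes ff: "(f, f') \<in> almost_equal \<Omega>" and gg: "(g, g') \<in> almost_equal \<Omega>"
    and f: "f \<in> near_bijections \<Omega>"
  shows "(compose \<Omega> g f, compose \<Omega> g' f') \<in> almost_equal \<Omega>"
proof -
  have E: "f \<in> \<Omega> \<rightarrow>\<^sub>E \<Omega>" "f' \<in> \<Omega> \<rightarrow>\<^sub>E \<Omega>" "g \<in> \<Omega> \<rightarrow>\<^sub>E \<Omega>" "g' \<in> \<Omega> \<rightarrow>\<^sub>E \<Omega>"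
    using ff gg by (auto simp: almost_equal_def)
  obtain A B where AB: "cofinite_bij \<Omega> f A B" using f by (rule near_bijectionsE)
  let ?F = "{w \<in> \<Omega>. g w \<noteq> g' w}"
  have "{w \<in> \<Omega>. compose \<Omega> g f w \<noteq> compose \<Omega> g' f' w} \<subseteq>
      {w \<in> \<Omega>. f w \<noteq> f' w} \<union> {w \<in> \<Omega>. f w \<in> ?F}"
    using E by (auto simp: compose_def)
  moreover have "finite {w \<in> \<Omega>. f w \<in> ?F}"
    using gg by (intro cofinite_bij_vimage_finite[OF AB]) (simp add: almost_equal_def)
  ultimately have "finite {w \<in> \<Omega>. compose \<Omega> g f w \<noteq> compose \<Omega> g' f' w}"
    using ff by (auto simp: almost_equal_def intro: finite_subset)
  moreover have "compose \<Omega> g f \<in> \<Omega> \<rightarrow>\<^sub>E \<Omega>" "compose \<Omega> g' f' \<in> \<Omega> \<rightarrow>\<^sub>E \<Omega>"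
    using E by (auto simp: compose_def)
  ultimately show ?thesis by (simp add: almost_equal_def)
qed

text \<open>Restricting \<open>f : A \<rightarrow> B\<close> and \<open>g : C \<rightarrow> D\<close> to the points that pass through \<open>B \<inter> C\<close> makes the two
  restrictions composable; the codimension of \<open>B \<inter> C\<close> then cancels in the sum of the indices.\<close>

lemma
  assumes f: "f \<in> near_bijections \<Omega>" and g: "g \<in> near_bijections \<Omega>"
  shows near_bijections_compose: "compose \<Omega> g f \<in> near_bijections \<Omega>"
    and ind_compose: "ind \<Omega> (compose \<Omega> g f) = ind \<Omega> g + ind \<Omega> f"
proof -
  obtain A B where fE: "f \<in> \<Omega> \<rightarrow>\<^sub>E \<Omega>" and AB: "cofinite_bij \<Omega> f A B"
    using f by (rule near_bijectionsE)
  obtain C D where gE: "g \<in> \<Omega> \<rightarrow>\<^sub>E \<Omega>" and CD: "cofinite_bij \<Omega> g C D"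
    using g by (rule near_bijectionsE)
  define E where "E = {w \<in> A. f w \<in> C}"
  have A: "cofinite_in \<Omega> A" "cofinite_in \<Omega> B" "B = f ` A"
    and C: "cofinite_in \<Omega> C"
    using AB CD by (auto simp: cofinite_bij_def bij_betw_def)
  have "cofinite_in \<Omega> E"
  proof (rule cofinite_in_superset[OF A(1)])
    show "finite {w \<in> \<Omega>. f w \<in> \<Omega> - C}"
      using C by (intro cofinite_bij_vimage_finite[OF AB]) (simp add: cofinite_in_def)
    show "A - {w \<in> \<Omega>. f w \<in> \<Omega> - C} \<subseteq> E" "E \<subseteq> \<Omega>"
      using A(1) fE by (auto simp: E_def cofinite_in_def)
  qed
  then have fE': "cofinite_bij \<Omega> f E (f ` E)"
    using AB by (intro cofinite_bij_shrink(1)) (auto simp: E_def)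
  have "f ` E = B \<inter> C" using A by (auto simp: E_def)
  then have gE': "cofinite_bij \<Omega> g (f ` E) (g ` f ` E)"
    using CD A C by (intro cofinite_bij_shrink(1)) (auto simp: cofinite_in_Int)
  have "bij_betw (g \<circ> f) E (g ` f ` E)"
    using fE' gE' by (auto simp: cofinite_bij_def intro: bij_betw_trans)
  moreover have "bij_betw (g \<circ> f) E (g ` f ` E) \<longleftrightarrow> bij_betw (compose \<Omega> g f) E (g ` f ` E)"
    using \<open>cofinite_in \<Omega> E\<close>
    by (intro bij_betw_cong) (auto simp: compose_def cofinite_in_def)
  ultimately have gf: "cofinite_bij \<Omega> (compose \<Omega> g f) E (g ` f ` E)"
    using fE' gE' by (simp add: cofinite_bij_def)
  moreover have gfE: "compose \<Omega> g f \<in> \<Omega> \<rightarrow>\<^sub>E \<Omega>"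
    using fE gE by (auto simp: compose_def)
  ultimately show "compose \<Omega> g f \<in> near_bijections \<Omega>" by (auto simp: near_bijections_iff)
  show "ind \<Omega> (compose \<Omega> g f) = ind \<Omega> g + ind \<Omega> f"
    using ind_eq_codim_diff[OF gfE gf] ind_eq_codim_diff[OF fE fE'] ind_eq_codim_diff[OF gE gE']
    by simp
qed

lemma near_bijections_inverse:
  assumes f: "f \<in> near_bijections \<Omega>"
  obtains g where "g \<in> near_bijections \<Omega>" "(compose \<Omega> g f, \<lambda>w\<in>\<Omega>. w) \<in> almost_equal \<Omega>"
proof -
  obtain A B where fE: "f \<in> \<Omega> \<rightarrow>\<^sub>E \<Omega>" and AB: "cofinite_bij \<Omega> f A B"
    using f by (rule near_bijectionsE)
  have A: "A \<subseteq> \<Omega>" "B \<subseteq> \<Omega>" "finite (\<Omega> - A)" and bij: "bij_betw f A B"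
    using AB by (auto simp: cofinite_bij_def cofinite_in_def)
  \<comment> \<open>Outside \<open>B\<close> any value in \<open>\<Omega>\<close> will do.\<close>
  define g where "g = (\<lambda>w\<in>\<Omega>. if w \<in> B then inv_into A f w else w)"
  have "bij_betw (inv_into A f) B A" using bij by (rule bij_betw_inv_into)
  moreover have "bij_betw (inv_into A f) B A \<longleftrightarrow> bij_betw g B A"
    using A by (intro bij_betw_cong) (auto simp: g_def)
  ultimately have gB: "bij_betw g B A" by simp
  have gE: "g \<in> \<Omega> \<rightarrow>\<^sub>E \<Omega>"
  proof
    show "g w \<in> \<Omega>" if "w \<in> \<Omega>" for w
    proof (cases "w \<in> B")
      case True
      then show ?thesis using bij_betwE[OF gB] A(1) by blast
    next
      case False
      then show ?thesis using that by (simp add: g_def)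
    qed
    show "g w = undefined" if "w \<notin> \<Omega>" for w using that by (simp add: g_def)
  qed
  have g: "g \<in> near_bijections \<Omega>"
    using gE gB AB by (auto simp: near_bijections_iff cofinite_bij_def)
  have "{w \<in> \<Omega>. compose \<Omega> g f w \<noteq> (\<lambda>w\<in>\<Omega>. w) w} \<subseteq> \<Omega> - A"
  proof -
    have "g (f w) = w" if "w \<in> A" for w
      using that bij A by (auto simp: g_def bij_betw_def inv_into_f_f)
    then show ?thesis by (auto simp: compose_def)
  qed
  then have "finite {w \<in> \<Omega>. compose \<Omega> g f w \<noteq> (\<lambda>w\<in>\<Omega>. w) w}"
    using A(3) by (rule finite_subset)
  moreover have "compose \<Omega> g f \<in> \<Omega> \<rightarrow>\<^sub>E \<Omega>" "(\<lambda>w\<in>\<Omega>. w) \<in> \<Omega> \<rightarrow>\<^sub>E \<Omega>"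
    using fE gE by (auto simp: compose_def)
  ultimately have "(compose \<Omega> g f, \<lambda>w\<in>\<Omega>. w) \<in> almost_equal \<Omega>"
    unfolding almost_equal_def by simp
  with g show thesis by (rule that)
qed

lemma bij_betw_imp_near_bijection:
  assumes "f \<in> \<Omega> \<rightarrow>\<^sub>E \<Omega>" "bij_betw f \<Omega> \<Omega>"
  shows "f \<in> near_bijections \<Omega>" and "ind \<Omega> f = 0"
proof -
  have "cofinite_bij \<Omega> f \<Omega> \<Omega>" using assms by (simp add: cofinite_bij_def cofinite_in_def)
  then show "f \<in> near_bijections \<Omega>" "ind \<Omega> f = 0"
    using assms(1) ind_eq_codim_diff by (fastforce simp: near_bijections_iff)+
qed

lemma id_near_bijection: "(\<lambda>w\<in>\<Omega>. w) \<in> near_bijections \<Omega>"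
  by (rule bij_betw_imp_near_bijection) (auto simp: bij_betw_def inj_on_def)

text \<open>Index zero means that the finite sets \<open>A'\<close> and \<open>B'\<close> have equally many points, so that a
  bijection \<open>A' \<rightarrow> B'\<close> can be glued to \<open>f : A \<rightarrow> B\<close>.\<close>

lemma almost_bijective_iff:
  "f \<in> almost_bijective \<Omega> \<longleftrightarrow> f \<in> near_bijections \<Omega> \<and> ind \<Omega> f = 0"
proof
  assume "f \<in> almost_bijective \<Omega>"
  then obtain b where "b \<in> \<Omega> \<rightarrow>\<^sub>E \<Omega>" "bij_betw b \<Omega> \<Omega>" and fb: "(f, b) \<in> almost_equal \<Omega>"
    by (auto simp: almost_bijective_def)
  then have b: "b \<in> near_bijections \<Omega>" "ind \<Omega> b = 0"
    using bij_betw_imp_near_bijection by blast+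
  have "(b, f) \<in> almost_equal \<Omega>" using fb equiv_almost_equal by (meson equivE symD)
  then show "f \<in> near_bijections \<Omega> \<and> ind \<Omega> f = 0"
    using b near_bijections_cong ind_cong by metis
next
  assume f: "f \<in> near_bijections \<Omega> \<and> ind \<Omega> f = 0"
  then obtain A B where fE: "f \<in> \<Omega> \<rightarrow>\<^sub>E \<Omega>" and AB: "cofinite_bij \<Omega> f A B"
    by (blast elim: near_bijectionsE)
  have A: "A \<subseteq> \<Omega>" "B \<subseteq> \<Omega>" "finite (\<Omega> - A)" "finite (\<Omega> - B)" and bij: "bij_betw f A B"
    using AB by (auto simp: cofinite_bij_def cofinite_in_def)
  have "card (\<Omega> - A) = card (\<Omega> - B)"
    using f ind_eq_codim_diff[OF fE AB] by simp
  then obtain h where h: "bij_betw h (\<Omega> - A) (\<Omega> - B)"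
    using A finite_same_card_bij by blast
  define b where "b = (\<lambda>w\<in>\<Omega>. if w \<in> A then f w else h w)"
  have "bij_betw b A B"
    using bij A(1) by (subst bij_betw_cong[where g = f]) (auto simp: b_def)
  moreover have "bij_betw b (\<Omega> - A) (\<Omega> - B)"
    using h by (subst bij_betw_cong[where g = h]) (auto simp: b_def)
  ultimately have "bij_betw b (A \<union> (\<Omega> - A)) (B \<union> (\<Omega> - B))"
    by (rule bij_betw_combine) auto
  moreover have "A \<union> (\<Omega> - A) = \<Omega>" "B \<union> (\<Omega> - B) = \<Omega>" using A by auto
  ultimately have b: "bij_betw b \<Omega> \<Omega>" by simp
  have "b \<in> extensional \<Omega>" by (simp add: b_def)
  with b have bE: "b \<in> \<Omega> \<rightarrow>\<^sub>E \<Omega>" by (auto simp: PiE_def bij_betw_def)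
  have "{w \<in> \<Omega>. f w \<noteq> b w} \<subseteq> \<Omega> - A" by (auto simp: b_def)
  then have "(f, b) \<in> almost_equal \<Omega>"
    using fE bE A(3) by (auto simp: almost_equal_def intro: finite_subset)
  then show "f \<in> almost_bijective \<Omega>"
    using b bE fE by (auto simp: almost_bijective_def)
qed

section \<open>The group of classes and the index homomorphism\<close>

abbreviation near_class :: "'a set \<Rightarrow> ('a \<Rightarrow> 'a) \<Rightarrow> ('a \<Rightarrow> 'a) set" where
  "near_class \<Omega> f \<equiv> almost_equal \<Omega> `` {f}"

lemma near_bijections_extensional: "f \<in> near_bijections \<Omega> \<Longrightarrow> f \<in> \<Omega> \<rightarrow>\<^sub>E \<Omega>"
  by (simp add: near_bijections_iff)

lemma near_class_eqI: "(f, g) \<in> almost_equal \<Omega> \<Longrightarrow> near_class \<Omega> f = near_class \<Omega> g"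
  by (rule equiv_class_eq[OF equiv_almost_equal])

lemma near_class_self: "f \<in> near_bijections \<Omega> \<Longrightarrow> f \<in> near_class \<Omega> f"
  by (rule equiv_class_self[OF equiv_almost_equal near_bijections_extensional])

lemma carrier_near_bijection_group:
  "carrier (near_bijection_group \<Omega>) = near_class \<Omega> ` near_bijections \<Omega>"
  by (auto simp: near_bijection_group_def quotient_def)

lemma carrier_almost_bijective_group:
  "carrier (almost_bijective_group \<Omega>) = near_class \<Omega> ` almost_bijective \<Omega>"
  by (auto simp: almost_bijective_group_def quotient_def)

lemma one_near_bijection_group:
  "\<one>\<^bsub>near_bijection_group \<Omega>\<^esub> = near_class \<Omega> (\<lambda>w\<in>\<Omega>. w)"
  by (simp add: near_bijection_group_def)

lemma mult_near_class:
  assumes f: "f \<in> near_bijections \<Omega>" and g: "g \<in> near_bijections \<Omega>"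
  shows "near_class \<Omega> g \<otimes>\<^bsub>near_bijection_group \<Omega>\<^esub> near_class \<Omega> f = near_class \<Omega> (compose \<Omega> g f)"
proof -
  have eq: "near_class \<Omega> (compose \<Omega> g' f') = near_class \<Omega> (compose \<Omega> g f)"
    if "g' \<in> near_class \<Omega> g" "f' \<in> near_class \<Omega> f" for g' f'
    using near_class_eqI[OF almost_equal_compose[OF _ _ f]] that by blast
  have "near_class \<Omega> g \<otimes>\<^bsub>near_bijection_group \<Omega>\<^esub> near_class \<Omega> f =
      (\<Union>g'\<in>near_class \<Omega> g. \<Union>f'\<in>near_class \<Omega> f. near_class \<Omega> (compose \<Omega> g' f'))"
    by (simp add: near_bijection_group_def)
  also have "\<dots> = (\<Union>g'\<in>near_class \<Omega> g. \<Union>f'\<in>near_class \<Omega> f. near_class \<Omega> (compose \<Omega> g f))"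
    by (intro SUP_cong refl eq)
  also have "\<dots> = near_class \<Omega> (compose \<Omega> g f)"
    using near_class_self[OF f] near_class_self[OF g] by auto
  finally show ?thesis .
qed

lemma group_near_bijection_group: "group (near_bijection_group \<Omega>)" (is "group ?G")
proof (rule groupI)
  show "\<one>\<^bsub>?G\<^esub> \<in> carrier ?G"
    by (simp add: one_near_bijection_group carrier_near_bijection_group id_near_bijection)
next
  fix X Y assume "X \<in> carrier ?G" "Y \<in> carrier ?G"
  then show "X \<otimes>\<^bsub>?G\<^esub> Y \<in> carrier ?G"
    by (auto simp: carrier_near_bijection_group mult_near_class near_bijections_compose)
next
  fix X Y Z assume "X \<in> carrier ?G" "Y \<in> carrier ?G" "Z \<in> carrier ?G"
  then obtain f g h where fgh: "f \<in> near_bijections \<Omega>" "g \<in> near_bijections \<Omega>"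
    "h \<in> near_bijections \<Omega>" and X: "X = near_class \<Omega> f" "Y = near_class \<Omega> g" "Z = near_class \<Omega> h"
    by (auto simp: carrier_near_bijection_group)
  have "compose \<Omega> (compose \<Omega> f g) h = compose \<Omega> f (compose \<Omega> g h)"
    using near_bijections_extensional[OF fgh(3)] by (auto simp: compose_def fun_eq_iff)
  then show "X \<otimes>\<^bsub>?G\<^esub> Y \<otimes>\<^bsub>?G\<^esub> Z = X \<otimes>\<^bsub>?G\<^esub> (Y \<otimes>\<^bsub>?G\<^esub> Z)"
    by (simp add: X fgh mult_near_class near_bijections_compose)
next
  fix X assume "X \<in> carrier ?G"
  then obtain f where f: "f \<in> near_bijections \<Omega>" and X: "X = near_class \<Omega> f"
    by (auto simp: carrier_near_bijection_group)
  have "compose \<Omega> (\<lambda>w\<in>\<Omega>. w) f = f"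
    using near_bijections_extensional[OF f]
    by (auto simp: compose_def fun_eq_iff PiE_def extensional_def)
  then show "\<one>\<^bsub>?G\<^esub> \<otimes>\<^bsub>?G\<^esub> X = X"
    by (simp add: X f one_near_bijection_group mult_near_class id_near_bijection)
  obtain g where g: "g \<in> near_bijections \<Omega>" "(compose \<Omega> g f, \<lambda>w\<in>\<Omega>. w) \<in> almost_equal \<Omega>"
    using f by (rule near_bijections_inverse)
  have "near_class \<Omega> g \<otimes>\<^bsub>?G\<^esub> X = \<one>\<^bsub>?G\<^esub>"
    using near_class_eqI[OF g(2)] by (simp add: X f g(1) mult_near_class one_near_bijection_group)
  then show "\<exists>Y\<in>carrier ?G. Y \<otimes>\<^bsub>?G\<^esub> X = \<one>\<^bsub>?G\<^esub>"
    using g(1) by (auto simp: carrier_near_bijection_group)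
qed

lemma Ind_near_class:
  assumes "f \<in> near_bijections \<Omega>"
  shows "Ind \<Omega> (near_class \<Omega> f) = ind \<Omega> f"
proof -
  have "ind \<Omega> g = ind \<Omega> f" if "g \<in> near_class \<Omega> f" for g
    using that ind_cong[OF _ assms, of g] by simp
  then have "ind \<Omega> ` near_class \<Omega> f = {ind \<Omega> f}"
    using near_class_self[OF assms] by (metis (no_types, lifting) empty_iff image_constant_conv
      image_cong)
  then show ?thesis by (simp add: Ind_def)
qed

lemma group_hom_Ind: "group_hom (near_bijection_group \<Omega>) integer_group (Ind \<Omega>)"
proof -
  have "Ind \<Omega> (X \<otimes>\<^bsub>near_bijection_group \<Omega>\<^esub> Y) = Ind \<Omega> X + Ind \<Omega> Y"
    if XY: "X \<in> carrier (near_bijection_group \<Omega>)" "Y \<in> carrier (near_bijection_group \<Omega>)" for X Y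
  proof -
    obtain f g where "f \<in> near_bijections \<Omega>" "g \<in> near_bijections \<Omega>"
      "X = near_class \<Omega> f" "Y = near_class \<Omega> g"
      using XY by (auto simp: carrier_near_bijection_group)
    then show ?thesis
      by (simp add: mult_near_class Ind_near_class near_bijections_compose ind_compose)
  qed
  then have "Ind \<Omega> \<in> hom (near_bijection_group \<Omega>) integer_group"
    by (simp add: hom_def)
  then show ?thesis
    by (simp add: group_hom_def group_hom_axioms_def group_near_bijection_group)
qed

lemma kernel_Ind:
  "kernel (near_bijection_group \<Omega>) integer_group (Ind \<Omega>) = carrier (almost_bijective_group \<Omega>)"
  by (auto simp: kernel_def carrier_near_bijection_group carrier_almost_bijective_group
      almost_bijective_iff Ind_near_class)

section \<open>Shifts along an injective sequence\<close>

text \<open>The truncation of \<open>nat\<close> sends the points \<open>s k\<close> with \<open>k < n\<close> to \<open>s 0\<close>. Shifting downwards for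
  \<open>n > 0\<close> is what makes the index equal to \<open>n\<close> instead of \<open>- n\<close>.\<close>

definition seq_shift :: "'a set \<Rightarrow> (nat \<Rightarrow> 'a) \<Rightarrow> int \<Rightarrow> 'a \<Rightarrow> 'a" where
  "seq_shift \<Omega> s n =
     (\<lambda>w\<in>\<Omega>. if w \<in> range s then s (nat (int (inv_into UNIV s w) - n)) else w)"

lemma seq_shift_seq:
  "inj s \<Longrightarrow> range s \<subseteq> \<Omega> \<Longrightarrow> seq_shift \<Omega> s n (s k) = s (nat (int k - n))"
  by (auto simp: seq_shift_def)

lemma seq_shift_other:
  "w \<in> \<Omega> \<Longrightarrow> w \<notin> range s \<Longrightarrow> seq_shift \<Omega> s n w = w"
  by (simp add: seq_shift_def)

lemma seq_shift_extensional:
  "range s \<subseteq> \<Omega> \<Longrightarrow> seq_shift \<Omega> s n \<in> \<Omega> \<rightarrow>\<^sub>E \<Omega>"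
  unfolding seq_shift_def by (rule restrict_PiE_iff[THEN iffD2]) (auto intro: subsetD)

text \<open>The bijective restriction is undone by the shift in the opposite direction.\<close>

lemma cofinite_bij_seq_shift:
  assumes s: "inj s" "range s \<subseteq> \<Omega>"
  shows "cofinite_bij \<Omega> (seq_shift \<Omega> s n) (\<Omega> - s ` {..<nat n}) (\<Omega> - s ` {..<nat (- n)})"
proof -
  have maps: "seq_shift \<Omega> s m w \<in> \<Omega> - s ` {..<nat (- m)}"
    and undo: "seq_shift \<Omega> s (- m) (seq_shift \<Omega> s m w) = w"
    if w: "w \<in> \<Omega> - s ` {..<nat m}" for m w
  proof -
    have "seq_shift \<Omega> s m w \<in> \<Omega> - s ` {..<nat (- m)} \<and>
        seq_shift \<Omega> s (- m) (seq_shift \<Omega> s m w) = w"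
    proof (cases "w \<in> range s")
      case True
      then obtain k where k: "w = s k" by auto
      then have "int k \<ge> m" using w by auto
      then show ?thesis
        using s by (auto simp: k seq_shift_seq inj_eq)
    next
      case False
      then show ?thesis using w by (auto simp: seq_shift_other)
    qed
    then show "seq_shift \<Omega> s m w \<in> \<Omega> - s ` {..<nat (- m)}"
      "seq_shift \<Omega> s (- m) (seq_shift \<Omega> s m w) = w" by auto
  qed
  have "bij_betw (seq_shift \<Omega> s n) (\<Omega> - s ` {..<nat n}) (\<Omega> - s ` {..<nat (- n)})"
    using maps[of _ n] maps[of _ "- n"] undo[of _ n] undo[of _ "- n"]
    by (intro bij_betw_byWitness[where f' = "seq_shift \<Omega> s (- n)"]) auto
  moreover have "cofinite_in \<Omega> (\<Omega> - s ` {..<k})" for k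
    by (auto simp: cofinite_in_def intro: finite_subset[of _ "s ` {..<k}"])
  ultimately show ?thesis by (simp add: cofinite_bij_def)
qed

lemma seq_shift_near_bijection:
  "inj s \<Longrightarrow> range s \<subseteq> \<Omega> \<Longrightarrow> seq_shift \<Omega> s n \<in> near_bijections \<Omega>"
  by (meson near_bijections_iff cofinite_bij_seq_shift seq_shift_extensional)

lemma ind_seq_shift:
  assumes s: "inj s" "range s \<subseteq> \<Omega>"
  shows "ind \<Omega> (seq_shift \<Omega> s n) = n"
proof -
  have "\<Omega> - (\<Omega> - s ` {..<k}) = s ` {..<k}" for k using s by auto
  then have "codim \<Omega> (\<Omega> - s ` {..<k}) = int k" for k
    using s(1) by (simp add: card_image inj_on_subset)
  then show ?thesis
    using ind_eq_codim_diff[OF seq_shift_extensional[OF s(2)] cofinite_bij_seq_shift[OF s], of n]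
    by simp
qed

text \<open>Truncation can spoil additivity only at \<open>s k\<close> with \<open>k < n\<close>.\<close>

lemma seq_shift_add:
  assumes s: "inj s" "range s \<subseteq> \<Omega>"
  shows "(compose \<Omega> (seq_shift \<Omega> s m) (seq_shift \<Omega> s n), seq_shift \<Omega> s (m + n)) \<in> almost_equal \<Omega>"
proof -
  have "seq_shift \<Omega> s m (seq_shift \<Omega> s n w) = seq_shift \<Omega> s (m + n) w"
    if w: "w \<in> \<Omega>" "w \<notin> s ` {..<nat n}" for w
  proof (cases "w \<in> range s")
    case True
    then obtain k where k: "w = s k" by auto
    then have "int k \<ge> n" using w by auto
    then show ?thesis using s by (simp add: k seq_shift_seq algebra_simps)
  next
    case False
    then show ?thesis using w by (simp add: seq_shift_other)
  qed
  then have "{w \<in> \<Omega>. compose \<Omega> (seq_shift \<Omega> s m) (seq_shift \<Omega> s n) w \<noteq> seq_shift \<Omega> s (m + n) w}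
      \<subseteq> s ` {..<nat n}"
    by (auto simp: compose_def)
  then have "finite {w \<in> \<Omega>. compose \<Omega> (seq_shift \<Omega> s m) (seq_shift \<Omega> s n) w
      \<noteq> seq_shift \<Omega> s (m + n) w}"
    by (rule finite_subset) simp
  moreover have "compose \<Omega> (seq_shift \<Omega> s m) (seq_shift \<Omega> s n) \<in> \<Omega> \<rightarrow>\<^sub>E \<Omega>"
    using s seq_shift_near_bijection near_bijections_compose near_bijections_extensional by metis
  ultimately show ?thesis
    using seq_shift_extensional[OF s(2)] by (simp add: almost_equal_def)
qed

lemma Ind_splits:
  assumes "infinite \<Omega>"
  shows "\<exists>\<phi> \<in> hom integer_group (near_bijection_group \<Omega>). \<forall>n. Ind \<Omega> (\<phi> n) = n"
proof -
  obtain s :: "nat \<Rightarrow> 'a" where s: "inj s" "range s \<subseteq> \<Omega>"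
    using infinite_countable_subset[OF assms] by blast
  note nb = seq_shift_near_bijection[OF s]
  show ?thesis
  proof (intro bexI allI)
    show "Ind \<Omega> (near_class \<Omega> (seq_shift \<Omega> s n)) = n" for n
      by (simp add: Ind_near_class nb ind_seq_shift s)
    show "(\<lambda>n. near_class \<Omega> (seq_shift \<Omega> s n)) \<in> hom integer_group (near_bijection_group \<Omega>)"
      using near_class_eqI[OF seq_shift_add[OF s]]
      by (auto simp: hom_def carrier_near_bijection_group nb mult_near_class)
  qed
qed

section \<open>The split exact sequence\<close>

theorem mainTheorem5:
  fixes \<Omega> :: "'a set"
  assumes "infinite \<Omega>"
  shows "subgroup (carrier (almost_bijective_group \<Omega>)) (near_bijection_group \<Omega>)
       \<and> short_exact_seq (almost_bijective_group \<Omega>) (near_bijection_group \<Omega>) integer_group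
           (\<lambda>X. X) (Ind \<Omega>)
       \<and> (\<exists>\<phi> \<in> hom integer_group (near_bijection_group \<Omega>). \<forall>n. Ind \<Omega> (\<phi> n) = n)"
proof -
  let ?G = "near_bijection_group \<Omega>" and ?S = "almost_bijective_group \<Omega>"
  let ?Z = "integer_group"
  interpret G: group ?G by (rule group_near_bijection_group)
  interpret Ind: group_hom ?G ?Z "Ind \<Omega>" by (rule group_hom_Ind)
  have sub: "subgroup (carrier ?S) ?G"
    using Ind.subgroup_kernel by (simp add: kernel_Ind)
  have S: "?S = ?G\<lparr>carrier := carrier ?S\<rparr>"
    by (simp add: almost_bijective_group_def)
  have ops: "\<one>\<^bsub>?S\<^esub> = \<one>\<^bsub>?G\<^esub>" "mult ?S = mult ?G"
    by (simp_all add: almost_bijective_group_def)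
  interpret S: group ?S
    using G.subgroup_imp_group[OF sub] S by simp
  have incl: "group_hom ?S ?G (\<lambda>X. X)"
    using subgroup.subset[OF sub]
    by (auto simp: group_hom_def group_hom_axioms_def hom_def ops S.is_group G.is_group)
  obtain \<phi> where \<phi>: "\<phi> \<in> hom ?Z ?G" "\<And>n. Ind \<Omega> (\<phi> n) = n"
    using Ind_splits[OF assms] by blast
  have "exact_at (singleton_group \<one>\<^bsub>?S\<^esub>) ?S ?G (\<lambda>X. X) (\<lambda>X. X)"
    unfolding exact_at_def
  proof (intro conjI)
    have "(\<lambda>X. X) \<in> hom (singleton_group \<one>\<^bsub>?S\<^esub>) ?S"
      by (simp add: hom_def singleton_group_def)
    then show "group_hom (singleton_group \<one>\<^bsub>?S\<^esub>) ?S (\<lambda>X. X)"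
      by (simp add: group_hom_def group_hom_axioms_def S.is_group)
    show "(\<lambda>X. X) ` carrier (singleton_group \<one>\<^bsub>?S\<^esub>) = kernel ?S ?G (\<lambda>X. X)"
      by (auto simp: kernel_def ops(1)[symmetric])
  qed (rule incl)
  moreover have "exact_at ?S ?G ?Z (\<lambda>X. X) (Ind \<Omega>)"
    using incl group_hom_Ind by (simp add: exact_at_def kernel_Ind)
  moreover have "exact_at ?G ?Z (singleton_group \<one>\<^bsub>?Z\<^esub>) (Ind \<Omega>) (\<lambda>_. \<one>\<^bsub>?Z\<^esub>)"
  proof -
    have "n \<in> Ind \<Omega> ` carrier ?G" for n
    proof
      show "n = Ind \<Omega> (\<phi> n)" by (simp add: \<phi>(2))
      show "\<phi> n \<in> carrier ?G" using hom_carrier[OF \<phi>(1)] by auto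
    qed
    then have surj: "Ind \<Omega> ` carrier ?G = UNIV" by auto
    have "(\<lambda>_. \<one>\<^bsub>?Z\<^esub>) \<in> hom ?Z (singleton_group \<one>\<^bsub>?Z\<^esub>)"
      by (simp add: hom_def singleton_group_def)
    then have "group_hom ?Z (singleton_group \<one>\<^bsub>?Z\<^esub>) (\<lambda>_. \<one>\<^bsub>?Z\<^esub>)"
      by (simp add: group_hom_def group_hom_axioms_def)
    then show ?thesis
      unfolding exact_at_def using group_hom_Ind surj
      by (simp add: kernel_def singleton_group_def)
  qed
  ultimately show ?thesis
    using sub Ind_splits[OF assms] by (simp add: short_exact_seq_def)
qed

end
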